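(* Let $A,B\subset\mathbb{R}^d$ be nonempty closed convex sets and let $x_0\in\mathbb{R}^d$. Define, for all $k\ge 0$, $$y_{k+1}=P_A(x_k),\qquad x_{k+1}=P_B(y_{k+1}).$$ Then both sequences $\{x_k\}_{k\ge 0}$ and $\{y_k\}_{k\ge 1}$ are self-contracted.
   Context: $\mathbb{R}^d$ is the $d$-dimensional Euclidean space with norm $\|\cdot\|$. $P_C$ denotes the metric projection onto a nonempty closed convex set $C$. A sequence $\{x_k\}$ in $\mathbb{R}^d$ is called self-contracted if for all indices $k_1\le k_2\le k_3$ one has $\|x_{k_3}-x_{k_2}\|\le\|x_{k_3}-x_{k_1}\|$. *)

theory Defs
  imports "HOL-Analysis.Analysis"
begin

(* The index set I allows for sequences that start at an index other than 0. *)
definition self_contracted_on :: "nat set \<Rightarrow> (nat \<Rightarrow> 'a::real_normed_vector) \<Rightarrow> bool" where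
  "self_contracted_on I x \<longleftrightarrow>
     (\<forall>k1\<in>I. \<forall>k2\<in>I. \<forall>k3\<in>I. k1 \<le> k2 \<and> k2 \<le> k3 \<longrightarrow>
        norm (x k3 - x k2) \<le> norm (x k3 - x k1))"

end

theory Submission
  imports Defs
begin

text \<open>For \<open>z \<in> B\<close> the point \<open>P\<^sub>B (P\<^sub>A u)\<close> is no farther from \<open>z\<close> than \<open>u\<close>, provided that \<open>z\<close> is within
  distance \<open>\<parallel>P\<^sub>A u - P\<^sub>B (P\<^sub>A u)\<parallel>\<close> of \<open>A\<close>. The gaps \<open>\<parallel>P\<^sub>A x\<^sub>k - x\<^sub>k\<^sub>+\<^sub>1\<parallel>\<close> decrease along the iteration, so this
  applies to every later iterate \<open>z\<close>, and distances to it are nonincreasing. The sequence of the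
  \<open>y\<^sub>k\<close> is the same iteration with \<open>A\<close> and \<open>B\<close> exchanged.\<close>

lemma norm_alternating_projection_le:
  fixes A B :: "'a::euclidean_space set"
  assumes A: "closed A" "convex A" and B: "closed B" "convex B"
    and "w \<in> A" "z \<in> B"
    and y: "y = closest_point A u" and v: "v = closest_point B y"
    and gap: "norm (z - w) \<le> norm (y - v)"
  shows "norm (z - v) \<le> norm (z - u)"
proof -
  have 1: "(u - y) \<bullet> (w - y) \<le> 0"
    unfolding y using \<open>w \<in> A\<close> by (rule closest_point_dot[OF A(2,1)])
  have 2: "(y - v) \<bullet> (z - v) \<le> 0"
    unfolding v using \<open>z \<in> B\<close> by (rule closest_point_dot[OF B(2,1)])
  have 3: "(z - w) \<bullet> (z - w) \<le> (y - v) \<bullet> (y - v)"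
    using gap by (simp add: norm_le)
  \<comment> \<open>This vector is chosen so that
    \<open>(z - u) \<bullet> (z - u) - (z - v) \<bullet> (z - v)\<close> equals exactly this square,
    plus the slack in \<open>3\<close>, minus twice the left sides of \<open>1\<close> and
    \<open>2\<close>.\<close>
  have 4: "0 \<le> ((z - w) + (y - u)) \<bullet> ((z - w) + (y - u))"
    by simp
  have "(z - v) \<bullet> (z - v) \<le> (z - u) \<bullet> (z - u)"
    using 1 2 3 4 by (simp add: inner_diff inner_add inner_commute)
  then show ?thesis
    by (simp add: norm_le)
qed

lemma alternating_projections_self_contracted:
  fixes A B :: "'a::euclidean_space set"
  assumes A: "A \<noteq> {}" "closed A" "convex A" and B: "B \<noteq> {}" "closed B" "convex B"
    and p: "\<And>k. p (Suc k) = closest_point B (closest_point A (p k))"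
  shows "self_contracted_on UNIV p"
proof -
  define q where "q k = closest_point A (p k)" for k
  have qA: "q k \<in> A" for k
    unfolding q_def using A by (simp add: closest_point_in_set)
  have pq: "p (Suc k) = closest_point B (q k)" for k
    by (simp add: p q_def)
  have pB: "p (Suc k) \<in> B" for k
    unfolding p using B by (simp add: closest_point_in_set)
  define gap where "gap k = norm (p (Suc k) - q k)" for k
  \<comment> \<open>Each new projection is compared with the previous iterate in the same set:
    \<open>p (Suc k)\<close> in \<open>B\<close>, then \<open>q k\<close> in
    \<open>A\<close>.\<close>
  have "gap (Suc k) \<le> gap k" for k
  proof -
    have "gap (Suc k) \<le> dist (q (Suc k)) (p (Suc k))"
      using closest_point_le[OF B(2) pB, of "q (Suc k)" k]
      by (simp add: gap_def pq[of "Suc k"] dist_norm norm_minus_commute)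
    also have "\<dots> \<le> dist (p (Suc k)) (q k)"
      using closest_point_le[OF A(2) qA, of "p (Suc k)" k]
      by (simp add: q_def[of "Suc k"] dist_commute)
    finally show ?thesis
      by (simp add: gap_def dist_norm)
  qed
  then have gap_mono: "gap m \<le> gap k" if "k \<le> m" for k m
    using that by (rule lift_Suc_antimono_le)
  have step_le: "norm (p n - p (Suc k)) \<le> norm (p n - p k)" if "k < n" for k n
  proof -
    \<comment> \<open>\<open>p 0\<close> may lie outside \<open>B\<close>, but
      \<open>p (Suc m)\<close> is in \<open>B\<close> and has \<open>q m\<close> in \<open>A\<close>
      at distance \<open>gap m\<close>.\<close>
    obtain m where n: "n = Suc m" and "k \<le> m"
      using \<open>k < n\<close> by (cases n) auto
    show ?thesis
      unfolding n
    proof (rule norm_alternating_projection_le[OF A(2,3) B(2,3) qA[of m] pB q_def pq])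
      show "norm (p (Suc m) - q m) \<le> norm (q k - p (Suc k))"
        using gap_mono[OF \<open>k \<le> m\<close>] by (simp add: gap_def norm_minus_commute)
    qed
  qed
  have "norm (p n - p l) \<le> norm (p n - p k)" if "k \<le> l" "l \<le> n" for k l n
    using that
  proof (induction l rule: dec_induct)
    case (step l)
    then show ?case
      using step_le[of l n] by linarith
  qed simp
  then show ?thesis
    by (simp add: self_contracted_on_def)
qed

theorem theorem4p2:
  fixes A B :: "(real ^ 'd) set"
    and x0 :: "real ^ 'd"
    and x y :: "nat \<Rightarrow> real ^ 'd"
  assumes "A \<noteq> {}" and "closed A" and "convex A"
    and "B \<noteq> {}" and "closed B" and "convex B"
    and "x 0 = x0"
    and "\<And>k. y (k + 1) = closest_point A (x k)"
    and "\<And>k. x (k + 1) = closest_point B (y (k + 1))"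
  shows "self_contracted_on {0..} x \<and> self_contracted_on {1..} y"
proof
  have "self_contracted_on UNIV x"
    using assms(8,9) by (intro alternating_projections_self_contracted[OF assms(1-6)]) simp
  then show "self_contracted_on {0..} x"
    by (simp add: self_contracted_on_def)
  \<comment> \<open>The shift is needed because \<open>y 0\<close> is arbitrary: the iteration
    starts at \<open>y 1\<close>.\<close>
  have "self_contracted_on UNIV (\<lambda>k. y (Suc k))"
    using assms(8,9) by (intro alternating_projections_self_contracted[OF assms(4-6,1-3)]) simp
  then have "norm (y (Suc n) - y (Suc l)) \<le> norm (y (Suc n) - y (Suc k))"
    if "k \<le> l" "l \<le> n" for k l n
    using that by (simp add: self_contracted_on_def)
  then show "self_contracted_on {1..} y"
    unfolding self_contracted_on_def by (auto simp: Suc_le_eq gr0_conv_Suc)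
qed

end
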